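(* The map $\Phi_{1,\mathrm{sym}}$ is (defined on and restricts to) a length-preserving bijection from the set $\mathcal M^{\mathrm{bicol}}$ of bicoloured Motzkin paths to the set $\mathcal Q^{\mathrm{sym}}$ of quarter-plane walks with steps in $S_{1,\mathrm{sym}}$, and the map $\Psi_{1,\mathrm{sym}}$ (restricted to $\mathcal Q^{\mathrm{sym}}$) is the inverse bijection. Moreover, for every $n\in\mathbb N$, all the maps in the chain $$\mathcal Q^{\mathrm{sym}}(n)\xrightarrow{\ \Psi_{1,\mathrm{sym}}\ }\mathcal M^{\mathrm{bicol}}(n)\cong\mathcal M(n)\times 2^{[n]}\xrightarrow{\ \Phi_1\times\mathrm{id}\ }\mathcal Q(n)\times 2^{[n]}$$ are bijections, so that $|\mathcal Q^{\mathrm{sym}}(n)|=2^n\,|\mathcal Q(n)|$.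
   Context: $\mathbb N$ contains $0$; $2^{[n]}$ is the power set of $\{1,\dots,n\}$. For a class $\mathcal X$ of words, $\mathcal X(n)$ is the set of its words of length $n$. Classes of walks. $\mathcal M$: Motzkin words, i.e. words on $\{-1,0,1\}$ with total sum $0$ and all prefix sums $\ge0$. $\mathcal M^{\mathrm{bicol}}$: bicoloured Motzkin words, i.e. Motzkin words each letter of which carries one of two colours, "solid" or "striped" (the six coloured letters form the alphabet $\Sigma_{1,\mathrm{bicol}}$). The bijection $\mathcal M^{\mathrm{bicol}}(n)\cong\mathcal M(n)\times2^{[n]}$ sends a bicoloured word to the pair (underlying uncoloured word, set of positions of its striped letters). $S_1=\{(0,1),(-1,0),(1,-1)\}$ and $S_{1,\mathrm{sym}}=S_1\cup\{(1,0),(0,-1),(-1,1)\}$. $\mathcal Q$ (resp. $\mathcal Q^{\mathrm{sym}}$): words on $S_1$ (resp. $S_{1,\mathrm{sym}}$) all of whose prefixes have letter sum in $\mathbb N^2$. Transitions for the six-step model. A transition relates an input letter in $\Sigma_{1,\mathrm{bicol}}$ and a left counter $(h_L,v_L)\in\mathbb N^2$ to a right counter $(h_R,v_R)\in\mathbb N^2$ and an output letter in $S_{1,\mathrm{sym}}$. With arbitrary $\alpha,\beta\in\mathbb N$: (U1) solid $+1;\ (\alpha,\beta)\to(\alpha,\beta+1);\ (0,1)$. (L2) solid $0;\ (\alpha,\beta+1)\to(\alpha+1,\beta);\ (1,-1)$. (L1) solid $0;\ (\alpha,0)\to(\alpha,0);\ (0,1)$. (D3) solid $-1;\ (\alpha+1,\beta)\to(\alpha,\beta);\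 (-1,0)$. (D2) solid $-1;\ (0,\beta+1)\to(0,\beta);\ (1,-1)$. (DE) solid $-1;\ (0,0)\to$ error. (U1$'$) striped $+1;\ (\alpha,\beta)\to(\alpha+1,\beta);\ (1,0)$. (L2$'$) striped $0;\ (\alpha+1,\beta)\to(\alpha,\beta+1);\ (-1,1)$. (L1$'$) striped $0;\ (0,\beta)\to(0,\beta);\ (1,0)$. (D3$'$) striped $-1;\ (\alpha,\beta+1)\to(\alpha,\beta);\ (0,-1)$. (D2$'$) striped $-1;\ (\alpha+1,0)\to(\alpha,0);\ (-1,1)$. (DE$'$) striped $-1;\ (0,0)\to$ error. Each triple (input letter, $h_L,v_L$) matches exactly one transition, and each triple ($h_R,v_R$, output letter) matches the right side of exactly one non-error transition and determines its left side. $\Phi_{1,\mathrm{sym}}$: given a word $w_1\cdots w_n$ on $\Sigma_{1,\mathrm{bicol}}$, start with $(h_0,v_0)=(0,0)$; for $i=1,\dots,n$ apply the unique transition matching $(w_i,h_{i-1},v_{i-1})$ to get $(h_i,v_i)$ and $\bar w_i$; undefined if an error transition is used, otherwise the value is $\bar w_1\cdots\bar w_n$. $\Psi_{1,\mathrm{sym}}$: given $\bar w_1\cdots\bar w_n$ on $S_{1,\mathrm{sym}}$, start with $(h_n,v_n)=(0,0)$; for $i=n,\dots,1$ apply in reverse the unique non-error transition matching $(h_i,v_i,\bar w_i)$ to get $w_i$ and $(h_{i-1},v_{i-1})$; the value is $w_1\cdots w_n$. $\Phi_1$: the partial map from words on $\{-1,0,1\}$ to words on $S_1$ defined in the same left-to-right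 way as $\Phi_{1,\mathrm{sym}}$, using only the transitions (U1), (L2), (L1), (D3), (D2), (DE), with the colour "solid" dropped from the input letters. *)

theory Defs
  imports Main "HOL-Library.Sublist" "HOL-Library.Product_Plus"
begin

definition of_length :: "'a list set \<Rightarrow> nat \<Rightarrow> 'a list set" where
  "of_length X n = {w \<in> X. length w = n}"

definition motzkin :: "int list set" where
  "motzkin = {w \<in> lists {-1, 0, 1}. sum_list w = 0 \<and> (\<forall>u. prefix u w \<longrightarrow> sum_list u \<ge> 0)}"

datatype colour = Solid | Striped

type_synonym letter = "int \<times> colour"
type_synonym counter = "nat \<times> nat"
type_synonym step = "int \<times> int"

definition bicol_alphabet :: "letter set" where
  "bicol_alphabet = {-1, 0, 1} \<times> UNIV"

definition bicol_motzkin :: "letter list set" where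
  "bicol_motzkin = {w \<in> lists bicol_alphabet. map fst w \<in> motzkin}"

text \<open>Positions are counted from 1, whereas list indices start at 0.\<close>

definition split_colours :: "letter list \<Rightarrow> int list \<times> nat set" where
  "split_colours w = (map fst w, {i \<in> {1..length w}. snd (w ! (i - 1)) = Striped})"

definition S1 :: "step set" where
  "S1 = {(0, 1), (-1, 0), (1, -1)}"

definition S1sym :: "step set" where
  "S1sym = S1 \<union> {(1, 0), (0, -1), (-1, 1)}"

definition quarter_walks :: "step set \<Rightarrow> step list set" where
  "quarter_walks S = {w \<in> lists S. \<forall>u. prefix u w \<longrightarrow> sum_list u \<in> \<nat> \<times> \<nat>}"

datatype outcome = Next counter step | Error

inductive transition :: "letter \<Rightarrow> counter \<Rightarrow> outcome \<Rightarrow> bool" where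
  U1:  "transition (1, Solid) (a, b) (Next (a, b + 1) (0, 1))"
| L2:  "transition (0, Solid) (a, b + 1) (Next (a + 1, b) (1, -1))"
| L1:  "transition (0, Solid) (a, 0) (Next (a, 0) (0, 1))"
| D3:  "transition (-1, Solid) (a + 1, b) (Next (a, b) (-1, 0))"
| D2:  "transition (-1, Solid) (0, b + 1) (Next (0, b) (1, -1))"
| DE:  "transition (-1, Solid) (0, 0) Error"
| U1': "transition (1, Striped) (a, b) (Next (a + 1, b) (1, 0))"
| L2': "transition (0, Striped) (a + 1, b) (Next (a, b + 1) (-1, 1))"
| L1': "transition (0, Striped) (0, b) (Next (0, b) (1, 0))"
| D3': "transition (-1, Striped) (a, b + 1) (Next (a, b) (0, -1))"
| D2': "transition (-1, Striped) (a + 1, 0) (Next (a, 0) (-1, 1))"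
| DE': "transition (-1, Striped) (0, 0) Error"

text \<open>The next two facts justify the definite descriptions used further below.\<close>

lemma transition_forward_unique:
  assumes "x \<in> bicol_alphabet"
  shows "\<exists>!r. transition x p r"
proof -
  obtain h v where p: "p = (h, v)" by (cases p)
  obtain s c where x: "x = (s, c)" "s = -1 \<or> s = 0 \<or> s = 1"
    using assms by (cases x) (auto simp: bicol_alphabet_def)
  show ?thesis
    unfolding p x(1) using x(2)
    by (cases c; cases h; cases v; elim disjE; simp add: transition.simps)
qed

lemma transition_backward_unique:
  assumes "s \<in> S1sym"
  shows "\<exists>!(x, p). transition x p (Next q s)"
proof -
  obtain h v where q: "q = (h, v)" by (cases q)
  have s: "s = (0, 1) \<or> s = (-1, 0) \<or> s = (1, -1) \<or> s = (1, 0) \<or> s = (0, -1) \<or> s = (-1, 1)"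
    using assms by (auto simp: S1sym_def S1_def)
  show ?thesis
    unfolding q using s
    by (cases h; cases v; elim disjE; simp add: transition.simps Ex1_def split_paired_Ex; auto)
qed

text \<open>
  Left-to-right reading of a word for a transition table \<open>T\<close> from a given counter;
  \<open>None\<close> means that an error transition was used.
\<close>

fun run :: "('a \<Rightarrow> counter \<Rightarrow> outcome \<Rightarrow> bool) \<Rightarrow> counter \<Rightarrow> 'a list \<Rightarrow> step list option" where
  "run T p [] = Some []"
| "run T p (x # w) =
    (case (THE r. T x p r) of
       Error \<Rightarrow> None
     | Next q s \<Rightarrow> map_option (\<lambda>u. s # u) (run T q w))"

text \<open>As partial maps, these are meant on words over the respective input alphabets only.\<close>

definition Phi1sym :: "letter list \<Rightarrow> step list option" where
  "Phi1sym w = run transition (0, 0) w"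

definition Phi1 :: "int list \<Rightarrow> step list option" where
  "Phi1 w = run (\<lambda>x. transition (x, Solid)) (0, 0) w"

text \<open>
  Right-to-left reading, from the counter \<open>(0, 0)\<close> at the right end; the first
  component of the result is the counter reached at the left end.
\<close>

fun run_back :: "step list \<Rightarrow> counter \<times> letter list" where
  "run_back [] = ((0, 0), [])"
| "run_back (s # u) =
    (let (q, w) = run_back u;
         (x, p) = (THE (x, p). transition x p (Next q s))
     in (p, x # w))"

definition Psi1sym :: "step list \<Rightarrow> letter list" where
  "Psi1sym u = snd (run_back u)"

end

theory Submission
  imports Defs
begin

text \<open>
  Two invariants govern the counter \<open>(h, v)\<close>. Reading forwards, \<open>h + v\<close> is the current height of
  the input path, so an error occurs exactly when that path would become negative, and the final
  counter is \<open>(0, 0)\<close> exactly when the path returns to height \<open>0\<close>. Reading backwards, every transition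
  with output \<open>s\<close> replaces \<open>(h, v)\<close> by the componentwise maximum of \<open>(h, v) - s\<close> and \<open>(0, 0)\<close>, so
  \<open>(h, v)\<close> is the least position from which the remaining output walk stays in the quarter plane;
  it is \<open>(0, 0)\<close> at the left end exactly when the whole walk stays there. Finally, a transition
  reads a solid letter exactly when its output lies in \<open>S1\<close>, so \<open>Phi1\<close> is the restriction of
  \<open>Phi1sym\<close> to solid words.
\<close>

text \<open>As a relation, this is neutral between the two reading directions, so facts about
  \<open>run\<close> and \<open>run_back\<close> can share one induction. The right end is fixed at
  \<open>(0, 0)\<close>; what remains to be controlled is the left counter.\<close>

inductive trace :: "counter \<Rightarrow> letter list \<Rightarrow> step list \<Rightarrow> bool" where
  Nil: "trace (0, 0) [] []"
| Cons: "transition x p (Next q s) \<Longrightarrow> trace q w u \<Longrightarrow> trace p (x # w) (s # u)"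

lemma all_prefix_Cons:
  "(\<forall>u. prefix u (x # w) \<longrightarrow> P u) \<longleftrightarrow> P [] \<and> (\<forall>u. prefix u w \<longrightarrow> P (x # u))"
  by (auto simp: prefix_Cons)

section \<open>Single transitions\<close>

lemma transition_in_bicol_alphabet: "transition x p r \<Longrightarrow> x \<in> bicol_alphabet"
  by (erule transition.cases) (simp_all add: bicol_alphabet_def)

lemma transition_in_S1sym: "transition x p (Next q s) \<Longrightarrow> s \<in> S1sym"
  by (erule transition.cases) (simp_all add: S1sym_def S1_def)

lemma transition_solid_iff: "transition x p (Next q s) \<Longrightarrow> snd x = Solid \<longleftrightarrow> s \<in> S1"
  by (erule transition.cases) (simp_all add: S1_def)

lemma transition_height:
  "transition x p (Next q s) \<Longrightarrow> int (fst q + snd q) = int (fst p + snd p) + fst x"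
  by (erule transition.cases) simp_all

text \<open>The error transitions \<open>DE\<close> and \<open>DE'\<close> read \<open>-1\<close> at
  counter \<open>(0, 0)\<close>, which would bring the height to -1.\<close>

lemma transition_not_Error:
  assumes "x \<in> bicol_alphabet" "int (fst p + snd p) + fst x \<ge> 0"
  obtains q s where "transition x p (Next q s)"
proof -
  obtain r where r: "transition x p r"
    using transition_forward_unique[OF assms(1)] by blast
  moreover have "r \<noteq> Error"
    using r assms(2) by (cases rule: transition.cases) simp_all
  ultimately show thesis
    using that by (cases r) auto
qed

text \<open>The truncation at 0 takes effect exactly in \<open>L1\<close>, \<open>D2\<close>,
  \<open>L1'\<close> and \<open>D2'\<close>; in the other cases the left counter is the right one
  minus \<open>s\<close>.\<close>

lemma transition_least_position:
  assumes "transition x p (Next q s)"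
  shows "int (fst p) = max (int (fst q) - fst s) 0" "int (snd p) = max (int (snd q) - snd s) 0"
  using assms by - (erule transition.cases; simp)+

lemma the_transition_forward:
  assumes "transition x p r"
  shows "(THE r. transition x p r) = r"
  by (rule the1_equality[OF transition_forward_unique[OF transition_in_bicol_alphabet[OF assms]] assms])

lemma the_transition_backward:
  assumes "transition x p (Next q s)"
  shows "(THE (x, p). transition x p (Next q s)) = (x, p)"
  by (rule the1_equality[OF transition_backward_unique[OF transition_in_S1sym[OF assms]]])
    (simp add: assms)

section \<open>Traces and the two readings\<close>

lemma trace_run: "trace p w u \<Longrightarrow> run transition p w = Some u"
  by (induction rule: trace.induct) (auto simp: the_transition_forward)

lemma trace_run_back: "trace p w u \<Longrightarrow> run_back u = (p, w)"
  by (induction rule: trace.induct) (auto simp: the_transition_backward)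

lemma trace_length: "trace p w u \<Longrightarrow> length u = length w"
  by (induction rule: trace.induct) auto

lemma trace_solid_iff: "trace p w u \<Longrightarrow> snd ` set w \<subseteq> {Solid} \<longleftrightarrow> u \<in> lists S1"
  by (induction rule: trace.induct) (auto simp: transition_solid_iff)

text \<open>Reading backwards meets no error case, so every word on \<open>S1sym\<close> is the
  output of a trace; the quarter-plane condition shows only in \<open>p\<close>.\<close>

lemma ex_trace_backward:
  assumes "u \<in> lists S1sym"
  shows "\<exists>p w. trace p w u"
  using assms
proof (induction u)
  case Nil
  then show ?case by (blast intro: trace.Nil)
next
  case (Cons s u)
  then obtain q w where q: "trace q w u" by auto
  obtain x p where "transition x p (Next q s)"
    using transition_backward_unique[of s q] Cons.hyps by auto
  with q show ?case by (blast intro: trace.Cons)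
qed

lemma trace_in_lists:
  assumes "trace p w u"
  shows "w \<in> lists bicol_alphabet" "u \<in> lists S1sym"
  using assms
  by (induction rule: trace.induct)
    (auto intro: transition_in_bicol_alphabet transition_in_S1sym)

section \<open>Motzkin words as inputs, quarter-plane walks as outputs\<close>

lemma trace_input_height:
  assumes "trace p w u"
  shows "int (fst p + snd p) + sum_list (map fst w) = 0
    \<and> (\<forall>m. prefix m (map fst w) \<longrightarrow> int (fst p + snd p) + sum_list m \<ge> 0)"
  using assms
proof (induction rule: trace.induct)
  case Nil
  then show ?case by simp
next
  case (Cons x p q s w u)
  then show ?case
    by (simp add: all_prefix_Cons transition_height[OF Cons.hyps(1)] add.assoc del: of_nat_add)
qed

text \<open>Converse of \<open>trace_input_height\<close>. The counter \<open>p\<close> is arbitrary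
  so that the induction can pass to a suffix, which starts at height
  \<open>fst p + snd p\<close>.\<close>

lemma ex_trace_forward:
  assumes "w \<in> lists bicol_alphabet"
    and "int (fst p + snd p) + sum_list (map fst w) = 0"
    and "\<forall>m. prefix m (map fst w) \<longrightarrow> int (fst p + snd p) + sum_list m \<ge> 0"
  shows "\<exists>u. trace p w u"
  using assms
proof (induction w arbitrary: p)
  case Nil
  \<comment> \<open>Height 0 is a sum of two naturals, so both vanish and the run ends at the
    prescribed counter.\<close>
  then have "p = (0, 0)" by (cases p) auto
  then show ?case by (blast intro: trace.Nil)
next
  case (Cons x w)
  have *: "\<forall>m. prefix m (map fst w) \<longrightarrow> int (fst p + snd p) + fst x + sum_list m \<ge> 0"
    using Cons.prems by (simp add: all_prefix_Cons add.assoc)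
  \<comment> \<open>The empty prefix of the remaining word gives the height after \<open>x\<close>,
    which rules out an error.\<close>
  then have "int (fst p + snd p) + fst x \<ge> 0"
    by (metis Nil_prefix add.right_neutral sum_list.Nil)
  with Cons.hyps obtain q s where t: "transition x p (Next q s)"
    by (auto elim: transition_not_Error)
  have "\<exists>u. trace q w u"
    using Cons.prems *
    by (intro Cons.IH) (simp_all add: transition_height[OF t] add.assoc del: of_nat_add)
  with t show ?case by (blast intro: trace.Cons)
qed

text \<open>The start \<open>(a, b)\<close> is independent of the counter: after a step it moves by
  \<open>s\<close>, which need not lead from \<open>p\<close> to \<open>q\<close> when truncation
  occurs.\<close>

lemma trace_quarter_plane_iff:
  assumes "trace p w u"
  shows "(\<forall>z. prefix z u \<longrightarrow> a + fst (sum_list z) \<ge> 0 \<and> b + snd (sum_list z) \<ge> 0)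
    \<longleftrightarrow> int (fst p) \<le> a \<and> int (snd p) \<le> b"
  using assms
proof (induction arbitrary: a b rule: trace.induct)
  case Nil
  then show ?case by simp
next
  case (Cons x p q s w u)
  show ?case
    \<comment> \<open>The empty prefix demands \<open>a \<ge> 0\<close> and
      \<open>b \<ge> 0\<close>, the rest demands that \<open>(a, b)\<close> dominate
      \<open>q - s\<close>; jointly this is domination of the truncated difference, which is
      \<open>p\<close>.\<close>
    using Cons.IH[of "a + fst s" "b + snd s"] transition_least_position[OF Cons.hyps(1)]
    by (auto simp: all_prefix_Cons add.assoc)
qed

lemma bicol_motzkin_iff_trace: "w \<in> bicol_motzkin \<longleftrightarrow> (\<exists>u. trace (0, 0) w u)"
proof
  assume "w \<in> bicol_motzkin"
  then show "\<exists>u. trace (0, 0) w u"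
    by (intro ex_trace_forward) (auto simp: bicol_motzkin_def motzkin_def)
next
  assume "\<exists>u. trace (0, 0) w u"
  then obtain u where t: "trace (0, 0) w u" ..
  have "map fst w \<in> lists {-1, 0, 1}"
    using trace_in_lists(1)[OF t] by (fastforce simp: bicol_alphabet_def)
  then show "w \<in> bicol_motzkin"
    using trace_in_lists(1)[OF t] trace_input_height[OF t]
    by (simp add: bicol_motzkin_def motzkin_def)
qed

lemma mem_quarter_walks_iff:
  "u \<in> quarter_walks S \<longleftrightarrow>
    u \<in> lists S \<and> (\<forall>z. prefix z u \<longrightarrow> fst (sum_list z) \<ge> 0 \<and> snd (sum_list z) \<ge> 0)"
proof -
  have "s \<in> \<nat> \<times> \<nat> \<longleftrightarrow> fst s \<ge> 0 \<and> snd s \<ge> 0" for s :: step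
    by (cases s) (auto simp: Nats_altdef1)
  then show ?thesis by (simp add: quarter_walks_def)
qed

lemma trace_quarter_walks_iff:
  assumes "trace p w u"
  shows "u \<in> quarter_walks S1sym \<longleftrightarrow> p = (0, 0)"
  \<comment> \<open>The walk starts at the origin, and a pair of naturals bounded by
    \<open>(0, 0)\<close> equals it.\<close>
  using trace_quarter_plane_iff[OF assms, of 0 0] trace_in_lists[OF assms]
  by (cases p) (auto simp: mem_quarter_walks_iff)

lemma quarter_walks_iff_trace: "u \<in> quarter_walks S1sym \<longleftrightarrow> (\<exists>w. trace (0, 0) w u)"
proof
  assume u: "u \<in> quarter_walks S1sym"
  then obtain p w where "trace p w u"
    using ex_trace_backward[of u] by (auto simp: quarter_walks_def)
  with u show "\<exists>w. trace (0, 0) w u"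
    using trace_quarter_walks_iff by blast
qed (use trace_quarter_walks_iff in blast)

section \<open>The mutually inverse bijections\<close>

lemma trace_Phi1sym: "trace (0, 0) w u \<Longrightarrow> Phi1sym w = Some u"
  by (simp add: Phi1sym_def trace_run)

lemma trace_Psi1sym: "trace (0, 0) w u \<Longrightarrow> Psi1sym u = w"
  by (simp add: Psi1sym_def trace_run_back)

lemma trace_Phi1sym_if_bicol_motzkin:
  assumes "w \<in> bicol_motzkin"
  shows "trace (0, 0) w (the (Phi1sym w))"
  using assms trace_Phi1sym by (auto simp: bicol_motzkin_iff_trace)

lemma trace_Psi1sym_if_quarter_walk:
  assumes "u \<in> quarter_walks S1sym"
  shows "trace (0, 0) (Psi1sym u) u"
  using assms trace_Psi1sym by (auto simp: quarter_walks_iff_trace)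

lemma Psi1sym_Phi1sym: "w \<in> bicol_motzkin \<Longrightarrow> Psi1sym (the (Phi1sym w)) = w"
  by (intro trace_Psi1sym trace_Phi1sym_if_bicol_motzkin)

lemma Phi1sym_Psi1sym: "u \<in> quarter_walks S1sym \<Longrightarrow> Phi1sym (Psi1sym u) = Some u"
  by (intro trace_Phi1sym trace_Psi1sym_if_quarter_walk)

lemma Phi1sym_quarter_walk: "w \<in> bicol_motzkin \<Longrightarrow> the (Phi1sym w) \<in> quarter_walks S1sym"
  using trace_Phi1sym_if_bicol_motzkin quarter_walks_iff_trace by blast

lemma Psi1sym_bicol_motzkin: "u \<in> quarter_walks S1sym \<Longrightarrow> Psi1sym u \<in> bicol_motzkin"
  using trace_Psi1sym_if_quarter_walk bicol_motzkin_iff_trace by blast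

lemma length_Phi1sym: "w \<in> bicol_motzkin \<Longrightarrow> length (the (Phi1sym w)) = length w"
  by (rule trace_length[OF trace_Phi1sym_if_bicol_motzkin])

lemma length_Psi1sym: "u \<in> quarter_walks S1sym \<Longrightarrow> length (Psi1sym u) = length u"
  using trace_length trace_Psi1sym_if_quarter_walk by metis

lemma Phi1sym_defined: "w \<in> bicol_motzkin \<Longrightarrow> \<exists>u. Phi1sym w = Some u \<and> length u = length w"
  using bicol_motzkin_iff_trace trace_Phi1sym trace_length by metis

lemma bij_betw_Phi1sym: "bij_betw (\<lambda>w. the (Phi1sym w)) bicol_motzkin (quarter_walks S1sym)"
  by (rule bij_betw_byWitness[where f' = Psi1sym])
    (auto simp: Psi1sym_Phi1sym Phi1sym_Psi1sym Phi1sym_quarter_walk Psi1sym_bicol_motzkin)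

lemma bij_betw_Psi1sym: "bij_betw Psi1sym (quarter_walks S1sym) bicol_motzkin"
  by (rule bij_betw_byWitness[where f' = "\<lambda>w. the (Phi1sym w)"])
    (auto simp: Psi1sym_Phi1sym Phi1sym_Psi1sym Phi1sym_quarter_walk Psi1sym_bicol_motzkin)

lemma bij_betw_Psi1sym_of_length:
  "bij_betw Psi1sym (of_length (quarter_walks S1sym) n) (of_length bicol_motzkin n)"
  by (rule bij_betw_byWitness[where f' = "\<lambda>w. the (Phi1sym w)"])
    (auto simp: of_length_def Psi1sym_Phi1sym Phi1sym_Psi1sym Phi1sym_quarter_walk
      Psi1sym_bicol_motzkin length_Phi1sym length_Psi1sym)

section \<open>Separating the colours from the path\<close>

lemma bij_betw_split_colours:
  "bij_betw split_colours (of_length bicol_motzkin n) (of_length motzkin n \<times> Pow {1..n})"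
proof -
  \<comment> \<open>The inverse recolours the path; index \<open>i\<close> is position
    \<open>Suc i\<close>, since positions are counted from 1.\<close>
  define join :: "int list \<times> nat set \<Rightarrow> letter list" where
    "join = (\<lambda>(m, A). map (\<lambda>i. (m ! i, if Suc i \<in> A then Striped else Solid)) [0..<n])"
  show ?thesis
  proof (rule bij_betw_byWitness[where f' = join])
    show "\<forall>w \<in> of_length bicol_motzkin n. join (split_colours w) = w"
    proof
      fix w assume "w \<in> of_length bicol_motzkin n"
      then have n: "length w = n" by (simp add: of_length_def)
      show "join (split_colours w) = w"
      proof (rule nth_equalityI)
        fix i assume "i < length (join (split_colours w))"
        then have "i < n" by (simp add: join_def split_colours_def)
        then show "join (split_colours w) ! i = w ! i"
          using n by (cases "w ! i"; cases "snd (w ! i)") (auto simp: join_def split_colours_def)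
      qed (simp add: n join_def split_colours_def)
    qed
  next
    have map_join: "map fst (join (m, A)) = m" if "length m = n" for m A
      using that by (auto simp: join_def intro: nth_equalityI)
    have nth_join: "snd (join (m, A) ! (i - 1)) = Striped \<longleftrightarrow> i \<in> A" if "i \<in> {1..n}" for m A i
      using that by (auto simp: join_def split: if_splits)
    have len_join: "length (join (m, A)) = n" for m A
      by (simp add: join_def)
    show "\<forall>b \<in> of_length motzkin n \<times> Pow {1..n}. split_colours (join b) = b"
    proof (clarify, goal_cases)
      case (1 m A)
      then have "{i \<in> {1..n}. snd (join (m, A) ! (i - 1)) = Striped} = A"
        using nth_join by blast
      with 1 show ?case
        by (simp add: split_colours_def map_join len_join of_length_def)
    qed
    show "split_colours ` of_length bicol_motzkin n \<subseteq> of_length motzkin n \<times> Pow {1..n}"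
      by (auto simp: split_colours_def of_length_def bicol_motzkin_def)
    have "join (m, A) \<in> of_length bicol_motzkin n" if "m \<in> of_length motzkin n" for m A
    proof -
      have "set (join (m, A)) \<subseteq> set (map fst (join (m, A))) \<times> UNIV"
        by force
      also have "\<dots> \<subseteq> bicol_alphabet"
        using that by (auto simp: map_join of_length_def motzkin_def bicol_alphabet_def)
      finally show ?thesis
        using that by (auto simp: of_length_def bicol_motzkin_def map_join len_join)
    qed
    then show "join ` (of_length motzkin n \<times> Pow {1..n}) \<subseteq> of_length bicol_motzkin n"
      by blast
  qed
qed

section \<open>The three-step model and the count\<close>

abbreviation solid :: "int list \<Rightarrow> letter list" where
  "solid \<equiv> map (\<lambda>x. (x, Solid))"

text \<open>Both sides look up the same transition at each letter, even outside the
  alphabet.\<close>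

lemma run_solid: "run (\<lambda>x. transition (x, Solid)) p m = run transition p (solid m)"
  by (induction m arbitrary: p) (auto split: outcome.split)

lemma Phi1_eq: "Phi1 m = Phi1sym (solid m)"
  by (simp add: Phi1_def Phi1sym_def run_solid)

lemma solid_bicol_motzkin:
  assumes "m \<in> motzkin"
  shows "solid m \<in> bicol_motzkin"
  using assms by (auto simp: bicol_motzkin_def motzkin_def bicol_alphabet_def comp_def)

lemma quarter_walks_S1: "quarter_walks S1 = quarter_walks S1sym \<inter> lists S1"
  by (auto simp: quarter_walks_def S1sym_def)

lemma Phi1_defined: "m \<in> motzkin \<Longrightarrow> Phi1 m \<noteq> None"
  using Phi1sym_defined[OF solid_bicol_motzkin] by (auto simp: Phi1_eq)

lemma bij_betw_Phi1_of_length: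
  "bij_betw (\<lambda>m. the (Phi1 m)) (of_length motzkin n) (of_length (quarter_walks S1) n)"
proof (rule bij_betw_byWitness[where f' = "\<lambda>u. map fst (Psi1sym u)"])
  show "\<forall>m \<in> of_length motzkin n. map fst (Psi1sym (the (Phi1 m))) = m"
    by (simp add: of_length_def Phi1_eq Psi1sym_Phi1sym solid_bicol_motzkin comp_def)
  show "(\<lambda>m. the (Phi1 m)) ` of_length motzkin n \<subseteq> of_length (quarter_walks S1) n"
  proof (rule image_subsetI)
    fix m assume "m \<in> of_length motzkin n"
    then have m: "solid m \<in> bicol_motzkin" "length m = n"
      by (auto simp: of_length_def solid_bicol_motzkin)
    have "the (Phi1 m) \<in> lists S1"
      using trace_solid_iff[OF trace_Phi1sym_if_bicol_motzkin[OF m(1)]] by (auto simp: Phi1_eq)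
    then show "the (Phi1 m) \<in> of_length (quarter_walks S1) n"
      using Phi1sym_quarter_walk[OF m(1)] length_Phi1sym[OF m(1)] m(2)
      by (simp add: of_length_def quarter_walks_S1 Phi1_eq)
  qed
  \<comment> \<open>Steps in \<open>S1\<close> come from solid letters only, so erasing the colours
    in the proposed inverse loses nothing.\<close>
  have Psi1sym_solid: "solid (map fst (Psi1sym u)) = Psi1sym u" if "u \<in> quarter_walks S1" for u
  proof -
    have "snd ` set (Psi1sym u) \<subseteq> {Solid}"
      using that trace_solid_iff[OF trace_Psi1sym_if_quarter_walk] by (auto simp: quarter_walks_S1)
    then show ?thesis
      by (auto simp: prod_eq_iff intro!: map_idI)
  qed
  show "\<forall>u \<in> of_length (quarter_walks S1) n. the (Phi1 (map fst (Psi1sym u))) = u"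
    by (auto simp: of_length_def Phi1_eq Psi1sym_solid Phi1sym_Psi1sym quarter_walks_S1
      simp del: map_map)
  show "(\<lambda>u. map fst (Psi1sym u)) ` of_length (quarter_walks S1) n \<subseteq> of_length motzkin n"
    using Psi1sym_bicol_motzkin length_Psi1sym
    by (auto simp: of_length_def quarter_walks_S1 bicol_motzkin_def)
qed

text \<open>The factor \<open>2 ^ n\<close> counts the possible sets of striped positions.\<close>

lemma card_quarter_walks_S1sym:
  "card (of_length (quarter_walks S1sym) n) = 2 ^ n * card (of_length (quarter_walks S1) n)"
  using bij_betw_same_card[OF bij_betw_Psi1sym_of_length[of n]]
    bij_betw_same_card[OF bij_betw_split_colours[of n]]
    bij_betw_same_card[OF bij_betw_Phi1_of_length[of n]]
  by (simp add: card_cartesian_product card_Pow)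

theorem theorem8:
  shows "(\<forall>w \<in> bicol_motzkin. \<exists>u. Phi1sym w = Some u \<and> length u = length w)
    \<and> bij_betw (\<lambda>w. the (Phi1sym w)) bicol_motzkin (quarter_walks S1sym)
    \<and> bij_betw Psi1sym (quarter_walks S1sym) bicol_motzkin
    \<and> (\<forall>w \<in> bicol_motzkin. Psi1sym (the (Phi1sym w)) = w)
    \<and> (\<forall>u \<in> quarter_walks S1sym. Phi1sym (Psi1sym u) = Some u)
    \<and> (\<forall>n.
        bij_betw Psi1sym (of_length (quarter_walks S1sym) n) (of_length bicol_motzkin n)
      \<and> bij_betw split_colours (of_length bicol_motzkin n) (of_length motzkin n \<times> Pow {1..n})
      \<and> (\<forall>m \<in> of_length motzkin n. Phi1 m \<noteq> None)
      \<and> bij_betw (map_prod (\<lambda>m. the (Phi1 m)) id)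
          (of_length motzkin n \<times> Pow {1..n}) (of_length (quarter_walks S1) n \<times> Pow {1..n})
      \<and> card (of_length (quarter_walks S1sym) n) = 2 ^ n * card (of_length (quarter_walks S1) n))"
proof (intro conjI allI)
  show "\<forall>w \<in> bicol_motzkin. \<exists>u. Phi1sym w = Some u \<and> length u = length w"
    and "\<forall>w \<in> bicol_motzkin. Psi1sym (the (Phi1sym w)) = w"
    and "\<forall>u \<in> quarter_walks S1sym. Phi1sym (Psi1sym u) = Some u"
    and "\<And>n. \<forall>m \<in> of_length motzkin n. Phi1 m \<noteq> None"
    using Phi1sym_defined Psi1sym_Phi1sym Phi1sym_Psi1sym Phi1_defined
    unfolding of_length_def by blast+
qed (intro bij_betw_Phi1sym bij_betw_Psi1sym bij_betw_Psi1sym_of_length bij_betw_split_colours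
    bij_betw_map_prod bij_betw_Phi1_of_length bij_betw_id card_quarter_walks_S1sym)+

end
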